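(* Let $G$ be a group, $U$ a set, $f_G$ a normal soft int-group in $G$ over $U$, and $G/f_G=\{xf_G: x\in G\}$ the set of soft cosets of $f_G$. Then: (1) $(xf_G)\ast(yf_G)=(xy)f_G$ for all $x,y\in G$; (2) $(G/f_G,\ast)$ is a group. Moreover, if $G$ is Abelian then so is $G/f_G$.
   Context: Let $P(U)$ be the power set of $U$. A soft int-group in $G$ over $U$ is a function $f_G:G\to P(U)$ such that $f_G(xy)\supseteq f_G(x)\cap f_G(y)$ and $f_G(x^{-1})=f_G(x)$ for all $x,y\in G$; it is a normal soft int-group if moreover $f_G(xy)=f_G(yx)$ for all $x,y\in G$. For $a\in G$, the soft coset $af_G:G\to P(U)$ is defined by $(af_G)(x)=f_G(a^{-1}x)$ for all $x\in G$. The soft product of functions $f,g:G\to P(U)$ is $(f\ast g)(x)=\bigcup\{f(u)\cap g(v): u,v\in G,\ uv=x\}$ for all $x\in G$. *)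

theory Defs
  imports "HOL-Algebra.Group" "HOL-Library.FuncSet"
begin

text \<open>
  A function $G \to P(U)$ on a carrier-based group is a HOL function of which only the values on
  \<open>carrier G\<close> matter. Soft cosets and soft products are built with \<open>restrict\<close>, so that HOL
  equality between them is equality of functions on \<open>carrier G\<close>.
\<close>

definition soft_int_group :: "('a, 'm) monoid_scheme \<Rightarrow> 'u set \<Rightarrow> ('a \<Rightarrow> 'u set) \<Rightarrow> bool"
  where "soft_int_group G U f \<longleftrightarrow>
    f \<in> carrier G \<rightarrow> Pow U \<and>
    (\<forall>x\<in>carrier G. \<forall>y\<in>carrier G. f x \<inter> f y \<subseteq> f (x \<otimes>\<^bsub>G\<^esub> y)) \<and>
    (\<forall>x\<in>carrier G. f (inv\<^bsub>G\<^esub> x) = f x)"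

definition normal_soft_int_group :: "('a, 'm) monoid_scheme \<Rightarrow> 'u set \<Rightarrow> ('a \<Rightarrow> 'u set) \<Rightarrow> bool"
  where "normal_soft_int_group G U f \<longleftrightarrow>
    soft_int_group G U f \<and>
    (\<forall>x\<in>carrier G. \<forall>y\<in>carrier G. f (x \<otimes>\<^bsub>G\<^esub> y) = f (y \<otimes>\<^bsub>G\<^esub> x))"

definition soft_coset :: "('a, 'm) monoid_scheme \<Rightarrow> 'a \<Rightarrow> ('a \<Rightarrow> 'u set) \<Rightarrow> 'a \<Rightarrow> 'u set"
  where "soft_coset G a f = (\<lambda>x\<in>carrier G. f (inv\<^bsub>G\<^esub> a \<otimes>\<^bsub>G\<^esub> x))"

definition soft_product ::
  "('a, 'm) monoid_scheme \<Rightarrow> ('a \<Rightarrow> 'u set) \<Rightarrow> ('a \<Rightarrow> 'u set) \<Rightarrow> 'a \<Rightarrow> 'u set"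
  where "soft_product G f g = (\<lambda>x\<in>carrier G.
    \<Union>{f u \<inter> g v |u v. u \<in> carrier G \<and> v \<in> carrier G \<and> u \<otimes>\<^bsub>G\<^esub> v = x})"

text \<open>
  The record requires a designated unit; \<open>soft_coset G \<one>\<^bsub>G\<^esub> f\<close> is \<open>f\<close> restricted to
  \<open>carrier G\<close>.
\<close>

definition soft_quotient :: "('a, 'm) monoid_scheme \<Rightarrow> ('a \<Rightarrow> 'u set) \<Rightarrow> ('a \<Rightarrow> 'u set) monoid"
  where "soft_quotient G f =
    \<lparr>carrier = {soft_coset G x f |x. x \<in> carrier G},
     mult = soft_product G,
     one = soft_coset G \<one>\<^bsub>G\<^esub> f\<rparr>"

end

theory Submission
  imports Defs
begin

text \<open>At z, the product of the cosets of x and y is the union of f(x^-1 u) \<inter> f(y^-1 v)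
  over all factorizations z = uv. Normality lets y^-1 v be replaced by v y^-1, so u and v become
  adjacent and every such term lies below f(x^-1 z y^-1) = f((xy)^-1 z). The bound is attained at u
  = x, v = x^-1 z, because f takes its largest value at the unit
  (\<open>soft_int_group_subset_one\<close>). This gives the product formula
  \<open>soft_product_soft_coset\<close>. Hence x \<mapsto> x f is a multiplicative map of G onto
  the set of cosets, and the group axioms and commutativity pass to the image. Well-definedness is
  automatic, since \<open>soft_product\<close> acts on functions and not on representatives.\<close>

text \<open>Write the unit as x x^-1 and use that f agrees at x and x^-1.\<close>

lemma soft_int_group_subset_one:
  assumes "group G" "soft_int_group G U f" "x \<in> carrier G"
  shows "f x \<subseteq> f \<one>\<^bsub>G\<^esub>"
proof -
  interpret group G by fact
  have "f x \<inter> f (inv\<^bsub>G\<^esub> x) \<subseteq> f (x \<otimes>\<^bsub>G\<^esub> inv\<^bsub>G\<^esub> x)" and "f (inv\<^bsub>G\<^esub> x) = f x"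
    using assms(2,3) inv_closed[OF assms(3)] unfolding soft_int_group_def by blast+
  then show ?thesis using assms(3) by simp
qed

lemma soft_product_soft_coset:
  assumes "group G" "normal_soft_int_group G U f" and x: "x \<in> carrier G" and y: "y \<in> carrier G"
  shows "soft_product G (soft_coset G x f) (soft_coset G y f) = soft_coset G (x \<otimes>\<^bsub>G\<^esub> y) f"
proof -
  interpret group G by fact
  have int: "soft_int_group G U f"
    using assms(2) by (simp add: normal_soft_int_group_def)
  have inter: "f a \<inter> f b \<subseteq> f (a \<otimes>\<^bsub>G\<^esub> b)" and comm: "f (a \<otimes>\<^bsub>G\<^esub> b) = f (b \<otimes>\<^bsub>G\<^esub> a)"
    if "a \<in> carrier G" "b \<in> carrier G" for a b
    using assms(2) that by (auto simp: normal_soft_int_group_def soft_int_group_def)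
  \<comment> \<open>Upper bound for each term of the union; normality is used twice, to move y^-1
    behind v and then to bring it back to the front.\<close>
  have le: "f (inv\<^bsub>G\<^esub> x \<otimes>\<^bsub>G\<^esub> u) \<inter> f (inv\<^bsub>G\<^esub> y \<otimes>\<^bsub>G\<^esub> v) \<subseteq> f (inv\<^bsub>G\<^esub> (x \<otimes>\<^bsub>G\<^esub> y) \<otimes>\<^bsub>G\<^esub> (u \<otimes>\<^bsub>G\<^esub> v))"
    if u: "u \<in> carrier G" and v: "v \<in> carrier G" for u v
  proof -
    have "f (inv\<^bsub>G\<^esub> x \<otimes>\<^bsub>G\<^esub> u) \<inter> f (inv\<^bsub>G\<^esub> y \<otimes>\<^bsub>G\<^esub> v)
        = f (inv\<^bsub>G\<^esub> x \<otimes>\<^bsub>G\<^esub> u) \<inter> f (v \<otimes>\<^bsub>G\<^esub> inv\<^bsub>G\<^esub> y)"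
      using comm[of "inv\<^bsub>G\<^esub> y" v] v y by simp
    also have "\<dots> \<subseteq> f ((inv\<^bsub>G\<^esub> x \<otimes>\<^bsub>G\<^esub> u) \<otimes>\<^bsub>G\<^esub> (v \<otimes>\<^bsub>G\<^esub> inv\<^bsub>G\<^esub> y))"
      using u v x y by (intro inter) simp_all
    also have "\<dots> = f ((inv\<^bsub>G\<^esub> x \<otimes>\<^bsub>G\<^esub> (u \<otimes>\<^bsub>G\<^esub> v)) \<otimes>\<^bsub>G\<^esub> inv\<^bsub>G\<^esub> y)"
      using u v x y by (simp add: m_assoc)
    also have "\<dots> = f (inv\<^bsub>G\<^esub> y \<otimes>\<^bsub>G\<^esub> (inv\<^bsub>G\<^esub> x \<otimes>\<^bsub>G\<^esub> (u \<otimes>\<^bsub>G\<^esub> v)))"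
      using u v x y by (intro comm) simp_all
    also have "\<dots> = f (inv\<^bsub>G\<^esub> (x \<otimes>\<^bsub>G\<^esub> y) \<otimes>\<^bsub>G\<^esub> (u \<otimes>\<^bsub>G\<^esub> v))"
      using u v x y by (simp add: m_assoc inv_mult_group)
    finally show ?thesis .
  qed
  \<comment> \<open>The right side is the term for u = x, v = x^-1 z. Its first factor is f at the
    unit, which contains every value of f; its second equals the left side.\<close>
  have ge: "f (inv\<^bsub>G\<^esub> (x \<otimes>\<^bsub>G\<^esub> y) \<otimes>\<^bsub>G\<^esub> z)
      \<subseteq> f (inv\<^bsub>G\<^esub> x \<otimes>\<^bsub>G\<^esub> x) \<inter> f (inv\<^bsub>G\<^esub> y \<otimes>\<^bsub>G\<^esub> (inv\<^bsub>G\<^esub> x \<otimes>\<^bsub>G\<^esub> z))"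
    if z: "z \<in> carrier G" for z
    using soft_int_group_subset_one[OF assms(1) int, of "inv\<^bsub>G\<^esub> (x \<otimes>\<^bsub>G\<^esub> y) \<otimes>\<^bsub>G\<^esub> z"] x y z
    by (simp add: m_assoc inv_mult_group)
  show ?thesis
  proof
    fix z
    show "soft_product G (soft_coset G x f) (soft_coset G y f) z = soft_coset G (x \<otimes>\<^bsub>G\<^esub> y) f z"
    proof (cases "z \<in> carrier G")
      case True
      then have z: "x \<otimes>\<^bsub>G\<^esub> (inv\<^bsub>G\<^esub> x \<otimes>\<^bsub>G\<^esub> z) = z"
        using x by (simp add: m_assoc[symmetric])
      have "(\<Union>{f (inv\<^bsub>G\<^esub> x \<otimes>\<^bsub>G\<^esub> u) \<inter> f (inv\<^bsub>G\<^esub> y \<otimes>\<^bsub>G\<^esub> v) |u v.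
              u \<in> carrier G \<and> v \<in> carrier G \<and> u \<otimes>\<^bsub>G\<^esub> v = z})
          = f (inv\<^bsub>G\<^esub> (x \<otimes>\<^bsub>G\<^esub> y) \<otimes>\<^bsub>G\<^esub> z)" (is "\<Union>?S = _")
      proof
        show "\<Union>?S \<subseteq> f (inv\<^bsub>G\<^esub> (x \<otimes>\<^bsub>G\<^esub> y) \<otimes>\<^bsub>G\<^esub> z)"
          using le by blast
        have "f (inv\<^bsub>G\<^esub> x \<otimes>\<^bsub>G\<^esub> x) \<inter> f (inv\<^bsub>G\<^esub> y \<otimes>\<^bsub>G\<^esub> (inv\<^bsub>G\<^esub> x \<otimes>\<^bsub>G\<^esub> z)) \<in> ?S"
          using x True z by blast
        then show "f (inv\<^bsub>G\<^esub> (x \<otimes>\<^bsub>G\<^esub> y) \<otimes>\<^bsub>G\<^esub> z) \<subseteq> \<Union>?S"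
          using ge[OF True] by blast
      qed
      \<comment> \<open>Both u and v range over the carrier, so the \<open>restrict\<close> in
        \<open>soft_coset\<close> has no effect here.\<close>
      moreover have "?S = {soft_coset G x f u \<inter> soft_coset G y f v |u v.
          u \<in> carrier G \<and> v \<in> carrier G \<and> u \<otimes>\<^bsub>G\<^esub> v = z}"
        unfolding soft_coset_def by (intro Collect_cong ex_cong1) auto
      ultimately show ?thesis
        using True by (simp add: soft_product_def soft_coset_def)
    \<comment> \<open>Off the carrier both sides are \<open>undefined\<close>, by
      \<open>restrict\<close>.\<close>
    qed (simp add: soft_product_def soft_coset_def)
  qed
qed

text \<open>The product formula reduces each axiom to the same axiom in G; the inverse of a coset is
  the coset of the inverse of any representative.\<close>

lemma group_soft_quotient:
  assumes "group G" "normal_soft_int_group G U f"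
  shows "group (soft_quotient G f)"
proof -
  interpret group G by fact
  note prod = soft_product_soft_coset[OF assms]
  show ?thesis
  proof (rule groupI)
    fix A assume "A \<in> carrier (soft_quotient G f)"
    then obtain x where x: "x \<in> carrier G" "A = soft_coset G x f"
      by (auto simp: soft_quotient_def)
    then have "soft_product G (soft_coset G (inv\<^bsub>G\<^esub> x) f) A = soft_coset G \<one>\<^bsub>G\<^esub> f"
      by (simp add: prod)
    then show "\<exists>B\<in>carrier (soft_quotient G f).
        B \<otimes>\<^bsub>soft_quotient G f\<^esub> A = \<one>\<^bsub>soft_quotient G f\<^esub>"
      using x(1) by (auto simp: soft_quotient_def)
  \<comment> \<open>Closure, associativity and the left unit, computed on representatives.\<close>
  qed (auto simp: soft_quotient_def prod m_assoc)
qed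

lemma comm_group_soft_quotient:
  assumes "comm_group G" "normal_soft_int_group G U f"
  shows "comm_group (soft_quotient G f)"
proof -
  interpret comm_group G by fact
  note prod = soft_product_soft_coset[OF is_group assms(2)]
  interpret Q: group "soft_quotient G f"
    by (rule group_soft_quotient[OF is_group assms(2)])
  show ?thesis
    by (rule Q.group_comm_groupI) (auto simp: soft_quotient_def prod m_comm)
qed

theorem theorem3p36:
  fixes G :: "('a, 'm) monoid_scheme"
    and U :: "'u set"
    and f :: "'a \<Rightarrow> 'u set"
  assumes "group G"
    and "normal_soft_int_group G U f"
  shows "(\<forall>x\<in>carrier G. \<forall>y\<in>carrier G.
            soft_product G (soft_coset G x f) (soft_coset G y f) = soft_coset G (x \<otimes>\<^bsub>G\<^esub> y) f)
         \<and> group (soft_quotient G f)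
         \<and> (comm_group G \<longrightarrow> comm_group (soft_quotient G f))"
  using soft_product_soft_coset[OF assms] group_soft_quotient[OF assms]
    comm_group_soft_quotient[OF _ assms(2)]
  by blast

end
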